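(* Let $p\ge1$ and let $\mathcal{X}\in L^{0}[\mathcal{F}_{c}(\mathbb{R}^{p})]$ be any fuzzy random variable. Then the naive simplicial depth $D_{nS}$ satisfies the following. (P1) $D_{nS}(M\cdot C+B;\,M\cdot\mathcal{X}+B)=D_{nS}(C;\mathcal{X})$ for every non-singular matrix $M\in\mathcal{M}_{p\times p}(\mathbb{R})$ and all $B,C\in\mathcal{F}_{c}(\mathbb{R}^{p})$. Moreover, for every $A\in\mathcal{F}_{c}(\mathbb{R}^{p})$ with $D_{nS}(A;\mathcal{X})=\sup_{B\in\mathcal{F}_{c}(\mathbb{R}^{p})}D_{nS}(B;\mathcal{X})$: (P4a) $\lim_{\lambda\to\infty}D_{nS}(A+\lambda\cdot B;\mathcal{X})=0$ for all $B\in\mathcal{F}_{c}(\mathbb{R}^{p})\setminus\{\mathrm{I}_{\{0\}}\}$. (P4b) For each metric $d$ among $d_{r}$ with $r\in[1,\infty]$ and $\rho_{r}$ with $r\in[1,\infty)$: $\lim_{n\to\infty}D_{nS}(A_{n};\mathcal{X})=0$ for every sequence $\{A_{n}\}_{n}$ in $\mathcal{F}_{c}(\mathbb{R}^{p})$ with $\lim_{n\to\infty}d(A_{n},A)=\infty$.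
   Context: $\mathbb{S}^{p-1}=\{x\in\mathbb{R}^{p}:\|x\|=1\}$ is the unit sphere, $\mathcal{V}_{p}$ is the normalized Haar (uniform probability) measure on $\mathbb{S}^{p-1}$ (for $p=1$, mass $1/2$ at each of $\pm1$), $\nu$ is Lebesgue measure on $[0,1]$, and $\mathcal{M}_{p\times p}(\mathbb{R})$ is the set of real $p\times p$ matrices. $\mathcal{K}_{c}(\mathbb{R}^{p})$ is the class of non-empty compact convex subsets of $\mathbb{R}^{p}$, and $\mathrm{I}_{K}$ denotes the indicator function of a set $K$. Fuzzy sets: $\mathcal{F}_{c}(\mathbb{R}^{p})$ is the class of functions $A:\mathbb{R}^{p}\to[0,1]$ whose $\alpha$-levels $A_{\alpha}$ are non-empty, compact and convex for all $\alpha\in[0,1]$, where $A_{\alpha}=\{x:A(x)\ge\alpha\}$ for $\alpha\in(0,1]$ and $A_{0}$ is the closure of $\{x:A(x)>0\}$. The support function of $A$ is $s_{A}(u,\alpha)=\sup_{v\in A_{\alpha}}\langle u,v\rangle$, $(u,\alpha)\in\mathbb{S}^{p-1}\times[0,1]$. Operations: $(A+B)(t)=\sup_{x+y=t}\min\{A(x),B(y)\}$; for $\gamma\in\mathbb{R}$, $(\gamma\cdot A)(t)=A(t/\gamma)$ if $\gamma\ne0$ and $0\cdot A=\mathrm{I}_{\{0\}}$; for a matrix $M$, $(M\cdot A)(t)=\sup\{A(y):y\in\mathbb{R}^{p},\,My=t\}$. $M\cdot\mathcal{X}+B$ is defined pointwise in $\omega$. Metrics: with $d_{\mathcal{H}}$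 the Hausdorff metric on $\mathcal{K}_{c}(\mathbb{R}^{p})$ (for the Euclidean norm), $d_{r}(A,B)=\left(\int_{[0,1]}d_{\mathcal{H}}(A_{\alpha},B_{\alpha})^{r}\,d\nu(\alpha)\right)^{1/r}$ for $r\in[1,\infty)$, $d_{\infty}(A,B)=\sup_{\alpha\in[0,1]}d_{\mathcal{H}}(A_{\alpha},B_{\alpha})$, and $\rho_{r}(A,B)=\left(\int_{\mathbb{S}^{p-1}}\int_{[0,1]}|s_{A}(u,\alpha)-s_{B}(u,\alpha)|^{r}\,d\nu(\alpha)\,d\mathcal{V}_{p}(u)\right)^{1/r}$ for $r\in[1,\infty)$. Fuzzy random variables: let $(\Omega,\mathcal{A},\mathbb{P})$ be a probability space. A random compact set is a map $\Gamma:\Omega\to\mathcal{K}_{c}(\mathbb{R}^{p})$ with $\{\omega:\Gamma(\omega)\cap K\neq\emptyset\}\in\mathcal{A}$ for each $K\in\mathcal{K}_{c}(\mathbb{R}^{p})$. A fuzzy random variable is a map $\mathcal{X}:\Omega\to\mathcal{F}_{c}(\mathbb{R}^{p})$ such that for every $\alpha\in[0,1]$ the $\alpha$-level map $\omega\mapsto\mathcal{X}(\omega)_{\alpha}$ is a random compact set. $L^{0}[\mathcal{F}_{c}(\mathbb{R}^{p})]$ is the class of all fuzzy random variables; $s_{\mathcal{X}}(u,\alpha)$ denotes the real random variable $\omega\mapsto s_{\mathcal{X}(\omega)}(u,\alpha)$. Naive simplicial depth: let $\mathcal{X}_{1},\ldots,\mathcal{X}_{p+1}$ be independent copies of $\mathcal{X}$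 and $m_{\mathcal{X}}(u,\alpha)=\min_{1\le i\le p+1}s_{\mathcal{X}_{i}}(u,\alpha)$, $M_{\mathcal{X}}(u,\alpha)=\max_{1\le i\le p+1}s_{\mathcal{X}_{i}}(u,\alpha)$. For $A\in\mathcal{F}_{c}(\mathbb{R}^{p})$, $$D_{nS}(A;\mathcal{X})=\mathbb{P}\big(s_{A}(u,\alpha)\in[m_{\mathcal{X}}(u,\alpha),M_{\mathcal{X}}(u,\alpha)]\text{ for all }(u,\alpha)\in\mathbb{S}^{p-1}\times[0,1]\big)$$ (this event is measurable). *)

theory Defs
  imports "HOL-Probability.Probability"
begin

section \<open>Fuzzy sets\<close>

definition Kc :: "(real ^ 'n) set set" where
  "Kc = {K. K \<noteq> {} \<and> compact K \<and> convex K}"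

definition level :: "(real ^ 'n \<Rightarrow> real) \<Rightarrow> real \<Rightarrow> (real ^ 'n) set" where
  "level A \<alpha> = (if \<alpha> = 0 then closure {x. A x > 0} else {x. A x \<ge> \<alpha>})"

definition Fc :: "(real ^ 'n \<Rightarrow> real) set" where
  "Fc = {A. (\<forall>x. A x \<in> {0..1}) \<and> (\<forall>\<alpha>\<in>{0..1}. level A \<alpha> \<in> Kc)}"

definition supp :: "(real ^ 'n \<Rightarrow> real) \<Rightarrow> real ^ 'n \<Rightarrow> real \<Rightarrow> real" where
  "supp A u \<alpha> = (SUP v\<in>level A \<alpha>. u \<bullet> v)"

definition fuzzy_add :: "(real ^ 'n \<Rightarrow> real) \<Rightarrow> (real ^ 'n \<Rightarrow> real) \<Rightarrow> real ^ 'n \<Rightarrow> real"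
    (infixl "\<oplus>\<^sub>F" 65) where
  "(A \<oplus>\<^sub>F B) t = Sup {min (A x) (B y) | x y. x + y = t}"

definition fuzzy_scale :: "real \<Rightarrow> (real ^ 'n \<Rightarrow> real) \<Rightarrow> real ^ 'n \<Rightarrow> real"
    (infixr "\<cdot>\<^sub>F" 75) where
  "(\<gamma> \<cdot>\<^sub>F A) = (if \<gamma> = 0 then indicator {0} else (\<lambda>t. A (t /\<^sub>R \<gamma>)))"

text \<open>Inserting \<open>0\<close> makes the supremum over an empty set (\<open>t\<close> outside the range of \<open>M\<close>) equal
  to \<open>0\<close>, the least membership value; \<^term>\<open>Sup {} :: real\<close> is unspecified. As \<open>A \<ge> 0\<close>, nothing
  else changes.\<close>

definition fuzzy_matrix :: "real ^ 'n ^ 'n \<Rightarrow> (real ^ 'n \<Rightarrow> real) \<Rightarrow> real ^ 'n \<Rightarrow> real"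
    (infixr "\<odot>\<^sub>F" 75) where
  "(M \<odot>\<^sub>F A) t = Sup (insert 0 {A y | y. M *v y = t})"

section \<open>Metrics\<close>

definition hausdorff_dist :: "(real ^ 'n) set \<Rightarrow> (real ^ 'n) set \<Rightarrow> real" where
  "hausdorff_dist K L =
     max (SUP x\<in>K. INF y\<in>L. dist x y) (SUP y\<in>L. INF x\<in>K. dist x y)"

definition d_fin :: "real \<Rightarrow> (real ^ 'n \<Rightarrow> real) \<Rightarrow> (real ^ 'n \<Rightarrow> real) \<Rightarrow> real" where
  "d_fin r A B =
     (LINT \<alpha>:{0..1}|lborel. hausdorff_dist (level A \<alpha>) (level B \<alpha>) powr r) powr (1 / r)"

definition d_inf :: "(real ^ 'n \<Rightarrow> real) \<Rightarrow> (real ^ 'n \<Rightarrow> real) \<Rightarrow> real" where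
  "d_inf A B = (SUP \<alpha>\<in>{0..1}. hausdorff_dist (level A \<alpha>) (level B \<alpha>))"

text \<open>The normalized Haar measure on the unit sphere, as a Borel measure on the whole space
  concentrated on the sphere: the image of the uniform distribution on the unit ball under
  the radial projection \<open>x \<mapsto> x / \<parallel>x\<parallel>\<close>. The lemmas below confirm that it is a rotation-invariant
  probability measure on the sphere, which determines it.\<close>

definition sphere_haar :: "(real ^ 'n) measure" where
  "sphere_haar = distr (uniform_measure lborel (ball 0 1)) borel sgn"

definition rho :: "real \<Rightarrow> (real ^ 'n \<Rightarrow> real) \<Rightarrow> (real ^ 'n \<Rightarrow> real) \<Rightarrow> real" where
  "rho r A B =
     (LINT u:sphere 0 1|sphere_haar. LINT \<alpha>:{0..1}|lborel. \<bar>supp A u \<alpha> - supp B u \<alpha>\<bar> powr r)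
       powr (1 / r)"

lemma sgn_borel_measurable [measurable]: "(sgn :: real ^ 'n \<Rightarrow> _) \<in> borel_measurable borel"
proof -
  have "(\<lambda>x::real^'n. x /\<^sub>R norm x) \<in> borel_measurable borel" by measurable
  then show ?thesis by (simp add: sgn_div_norm[abs_def])
qed

lemma emeasure_unit_ball:
  "emeasure lborel (ball (0::real^'n) 1) \<noteq> 0" "emeasure lborel (ball (0::real^'n) 1) \<noteq> \<infinity>"
proof -
  have "measure lborel (ball (0::real^'n) 1) > 0"
    using content_ball_pos[of 1 "0::real^'n"] by simp
  then show "emeasure lborel (ball (0::real^'n) 1) \<noteq> 0"
    by (auto simp: measure_def)
  show "emeasure lborel (ball (0::real^'n) 1) \<noteq> \<infinity>"
    using emeasure_bounded_finite[of "ball (0::real^'n) 1"] by auto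
qed

lemma prob_space_sphere_haar: "prob_space (sphere_haar :: (real ^ 'n) measure)"
  unfolding sphere_haar_def
  by (intro prob_space.prob_space_distr prob_space_uniform_measure emeasure_unit_ball)
    (auto simp: measurable_def[of "uniform_measure _ _"] intro!: measurable_sets_borel)

lemma AE_sphere_haar: "AE u in (sphere_haar :: (real ^ 'n) measure). u \<in> sphere 0 1"
proof -
  have "AE x in lborel. x \<noteq> (0::real^'n)" by (rule AE_lborel_singleton)
  then have "AE x in uniform_measure lborel (ball 0 1). x \<noteq> (0::real^'n)"
    by (intro AE_uniform_measureI) auto
  then show ?thesis
    unfolding sphere_haar_def
    by (subst AE_distr_iff) (auto simp: norm_sgn elim!: AE_mp)
qed

lemma orthogonal_borel_measurable:
  fixes f :: "real ^ 'n \<Rightarrow> real ^ 'n"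
  assumes "orthogonal_transformation f"
  shows "f \<in> borel_measurable borel"
  using orthogonal_transformation_linear[OF assms]
  by (intro borel_measurable_continuous_onI linear_continuous_on) (simp add: linear_conv_bounded_linear)

lemma nn_integral_lborel_translate:
  fixes g :: "real ^ 'n \<Rightarrow> ennreal"
  assumes [measurable]: "g \<in> borel_measurable borel"
  shows "(\<integral>\<^sup>+x. g (c + x) \<partial>lborel) = (\<integral>\<^sup>+x. g x \<partial>lborel)"
  using nn_integral_distr[of "(+) c" lborel borel g] by (simp add: lborel_distr_plus)

lemma distr_orthogonal_lborel:
  fixes f :: "real ^ 'n \<Rightarrow> real ^ 'n"
  assumes f: "orthogonal_transformation f"
  shows "distr lborel borel f = lborel"
proof (rule measure_eqI)
  fix A assume "A \<in> sets (distr (lborel :: (real ^ 'n) measure) borel f)"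
  then have A[measurable]: "A \<in> sets borel" by simp
  define B where "B = ball (0 :: real ^ 'n) 1"
  have B[measurable]: "B \<in> sets borel" by (simp add: B_def)
  have fm[measurable]: "f \<in> borel_measurable borel" using f by (rule orthogonal_borel_measurable)
  have lin: "linear f" using f by (rule orthogonal_transformation_linear)
  have nf: "norm (f x) = norm x" for x using f by (simp add: orthogonal_transformation_norm)
  define g where "g = inv f"
  have fg: "f (g y) = y" for y
    using orthogonal_transformation_surj[OF f] by (simp add: g_def surj_f_inv_f)
  have fA: "f -` A \<in> sets borel" using measurable_sets_borel[OF fm A] by simp
  have "emeasure lborel (f -` A) * emeasure lborel B
      = (\<integral>\<^sup>+x. indicator A (f x) * (\<integral>\<^sup>+y. indicator B y \<partial>lborel) \<partial>lborel)"
    using fA by (simp add: nn_integral_multc indicator_vimage[symmetric] flip: nn_integral_indicator)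
  also have "\<dots> = (\<integral>\<^sup>+x. \<integral>\<^sup>+y. indicator A (f x) * indicator B (- f x + y) \<partial>lborel \<partial>lborel)"
  proof (rule nn_integral_cong)
    fix x
    have "(\<integral>\<^sup>+y. indicator A (f x) * indicator B (- f x + y) \<partial>lborel)
        = (\<integral>\<^sup>+y. indicator A (f x) * indicator B y \<partial>lborel)"
      by (rule nn_integral_lborel_translate[where g="\<lambda>y. indicator A (f x) * indicator B y"]) measurable
    also have "\<dots> = indicator A (f x) * (\<integral>\<^sup>+y. indicator B y \<partial>lborel)"
      by (rule nn_integral_cmult) measurable
    finally show "indicator A (f x) * (\<integral>\<^sup>+y. indicator B y \<partial>lborel)
        = (\<integral>\<^sup>+y. indicator A (f x) * indicator B (- f x + y) \<partial>lborel)" by (rule sym)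
  qed
  also have "\<dots> = (\<integral>\<^sup>+y. \<integral>\<^sup>+x. indicator A (f x) * indicator B (- f x + y) \<partial>lborel \<partial>lborel)"
    by (rule lborel_pair.Fubini') measurable
  also have "\<dots> = (\<integral>\<^sup>+y. \<integral>\<^sup>+x. indicator A (f x + y) * indicator B x \<partial>lborel \<partial>lborel)"
  proof (rule nn_integral_cong)
    fix y
    have "(\<integral>\<^sup>+x. indicator A (f x) * indicator B (- f x + y) \<partial>lborel)
        = (\<integral>\<^sup>+x. indicator A (f (g y + x)) * indicator B (- f (g y + x) + y) \<partial>lborel)"
      by (rule nn_integral_lborel_translate[symmetric, where g="\<lambda>x. indicator A (f x) * indicator B (- f x + y)"]) measurable
    then show "(\<integral>\<^sup>+x. indicator A (f x) * indicator B (- f x + y) \<partial>lborel)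
        = (\<integral>\<^sup>+x. indicator A (f x + y) * indicator B x \<partial>lborel)"
      by (simp add: linear_add[OF lin] fg nf B_def indicator_def add.commute)
  qed
  also have "\<dots> = (\<integral>\<^sup>+x. \<integral>\<^sup>+y. indicator A (f x + y) * indicator B x \<partial>lborel \<partial>lborel)"
    by (rule lborel_pair.Fubini') measurable
  also have "\<dots> = (\<integral>\<^sup>+x. emeasure lborel A * indicator B x \<partial>lborel)"
  proof (rule nn_integral_cong)
    fix x
    have "(\<integral>\<^sup>+y. indicator A (f x + y) * indicator B x \<partial>lborel)
        = (\<integral>\<^sup>+y. indicator A y * indicator B x \<partial>lborel)"
      by (rule nn_integral_lborel_translate[where g="\<lambda>y. indicator A y * indicator B x"]) measurable
    also have "\<dots> = (\<integral>\<^sup>+y. indicator A y \<partial>lborel) * indicator B x"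
      by (rule nn_integral_multc) measurable
    finally show "(\<integral>\<^sup>+y. indicator A (f x + y) * indicator B x \<partial>lborel)
        = emeasure lborel A * indicator B x" by simp
  qed
  also have "\<dots> = emeasure lborel A * emeasure lborel B"
    by (subst nn_integral_cmult) auto
  finally have "emeasure lborel (f -` A) = emeasure lborel A"
    using emeasure_unit_ball[where 'n='n] by (simp add: B_def ennreal_mult_cancel_left mult.commute[of _ "emeasure lborel (ball 0 1)"])
  then show "emeasure (distr lborel borel f) A = emeasure lborel A"
    by (simp add: emeasure_distr)
qed simp

lemma sphere_haar_rotation_invariant:
  fixes f :: "real ^ 'n \<Rightarrow> real ^ 'n"
  assumes f: "orthogonal_transformation f"
  shows "distr sphere_haar borel f = sphere_haar"
proof (rule measure_eqI)
  fix S assume "S \<in> sets (distr (sphere_haar :: (real^'n) measure) borel f)"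
  then have S[measurable]: "S \<in> sets borel" by simp
  have lin: "linear f" using f by (rule orthogonal_transformation_linear)
  have fm[measurable]: "f \<in> borel_measurable borel" using f by (rule orthogonal_borel_measurable)
  have nf: "norm (f x) = norm x" for x
    using f by (simp add: orthogonal_transformation_norm)
  have sf: "f (sgn x) = sgn (f x)" for x
    using lin by (simp add: sgn_div_norm nf linear_scale)
  have fS: "f -` S \<in> sets borel" using measurable_sets_borel[OF fm S] by simp
  have sS: "sgn -` T \<in> sets borel" if "T \<in> sets borel" for T :: "(real^'n) set"
    using measurable_sets_borel[OF sgn_borel_measurable that] by simp
  have e: "emeasure sphere_haar T =
      emeasure lborel (ball 0 1 \<inter> sgn -` T) / emeasure lborel (ball (0::real^'n) 1)"
    if "T \<in> sets borel" for T :: "(real^'n) set"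
    using that sS[OF that] unfolding sphere_haar_def by (subst emeasure_distr) auto
  have eq: "ball 0 1 \<inter> sgn -` (f -` S) = f -` (ball 0 1 \<inter> sgn -` S)"
    by (auto simp: sf nf)
  have "emeasure lborel (f -` (ball 0 1 \<inter> sgn -` S)) = emeasure (distr lborel borel f) (ball 0 1 \<inter> sgn -` S)"
    using sS[OF S] by (subst emeasure_distr) auto
  then have "emeasure lborel (ball 0 1 \<inter> sgn -` (f -` S)) = emeasure lborel (ball 0 1 \<inter> sgn -` S)"
    by (simp add: eq distr_orthogonal_lborel[OF f])
  then have "emeasure sphere_haar (f -` S) = emeasure sphere_haar S"
    using e[OF S] e[OF fS] by simp
  moreover have "emeasure (distr sphere_haar borel f) S = emeasure sphere_haar (f -` S)"
    using fS by (subst emeasure_distr) (auto simp: sphere_haar_def)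
  ultimately show "emeasure (distr sphere_haar borel f) S = emeasure sphere_haar S" by simp
qed (simp add: sphere_haar_def)

section \<open>Fuzzy random variables and naive simplicial depth\<close>

definition random_compact_set :: "'w measure \<Rightarrow> ('w \<Rightarrow> (real ^ 'n) set) \<Rightarrow> bool" where
  "random_compact_set P \<Gamma> \<longleftrightarrow>
     (\<forall>\<omega>\<in>space P. \<Gamma> \<omega> \<in> Kc) \<and> (\<forall>K\<in>Kc. {\<omega>\<in>space P. \<Gamma> \<omega> \<inter> K \<noteq> {}} \<in> sets P)"

definition fuzzy_random_variable :: "'w measure \<Rightarrow> ('w \<Rightarrow> real ^ 'n \<Rightarrow> real) \<Rightarrow> bool" where
  "fuzzy_random_variable P X \<longleftrightarrow>
     (\<forall>\<omega>\<in>space P. X \<omega> \<in> Fc) \<and> (\<forall>\<alpha>\<in>{0..1}. random_compact_set P (\<lambda>\<omega>. level (X \<omega>) \<alpha>))"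

text \<open>The independent copies \<open>X\<^sub>1, \<dots>, X\<^sub>p\<^sub>+\<^sub>1\<close> of \<open>X\<close> are realised on the product of \<open>p + 1\<close> copies of
  the underlying probability space, with \<open>X\<^sub>i = X \<circ> (i-th coordinate)\<close>; the lemma
  \<open>independent_copies\<close> below confirms that these are independent and distributed like \<open>X\<close>.\<close>

definition copy_index :: "'n::finite itself \<Rightarrow> nat set" where
  "copy_index _ = {1..CARD('n) + 1}"

definition copies_space :: "'n::finite itself \<Rightarrow> 'w measure \<Rightarrow> (nat \<Rightarrow> 'w) measure" where
  "copies_space n P = (\<Pi>\<^sub>M i\<in>copy_index n. P)"

definition min_supp :: "('w \<Rightarrow> real ^ 'n \<Rightarrow> real) \<Rightarrow> (nat \<Rightarrow> 'w) \<Rightarrow> real ^ 'n \<Rightarrow> real \<Rightarrow> real" where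
  "min_supp X \<omega> u \<alpha> = (MIN i\<in>copy_index TYPE('n). supp (X (\<omega> i)) u \<alpha>)"

definition max_supp :: "('w \<Rightarrow> real ^ 'n \<Rightarrow> real) \<Rightarrow> (nat \<Rightarrow> 'w) \<Rightarrow> real ^ 'n \<Rightarrow> real \<Rightarrow> real" where
  "max_supp X \<omega> u \<alpha> = (MAX i\<in>copy_index TYPE('n). supp (X (\<omega> i)) u \<alpha>)"

definition naive_simplicial_depth ::
    "'w measure \<Rightarrow> (real ^ 'n \<Rightarrow> real) \<Rightarrow> ('w \<Rightarrow> real ^ 'n \<Rightarrow> real) \<Rightarrow> real" where
  "naive_simplicial_depth P A X =
     measure (copies_space TYPE('n) P)
       {\<omega> \<in> space (copies_space TYPE('n) P).
          \<forall>u\<in>sphere 0 1. \<forall>\<alpha>\<in>{0..1}. supp A u \<alpha> \<in> {min_supp X \<omega> u \<alpha> .. max_supp X \<omega> u \<alpha>}}"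

text \<open>The \<open>\<sigma>\<close>-algebra on fuzzy sets with respect to which fuzzy random variables are exactly the
  measurable maps.\<close>

definition fuzzy_space :: "(real ^ 'n \<Rightarrow> real) measure" where
  "fuzzy_space = sigma Fc {{A\<in>Fc. level A \<alpha> \<inter> K \<noteq> {}} | \<alpha> K. \<alpha> \<in> {0..1} \<and> K \<in> Kc}"

lemma fuzzy_random_variable_iff_measurable:
  fixes X :: "'w \<Rightarrow> real ^ 'n \<Rightarrow> real"
  shows "fuzzy_random_variable P X \<longleftrightarrow> X \<in> measurable P fuzzy_space"
proof
  assume X: "fuzzy_random_variable P X"
  show "X \<in> measurable P fuzzy_space"
    unfolding fuzzy_space_def
  proof (rule measurable_measure_of)
    show "X \<in> space P \<rightarrow> Fc" using X by (auto simp: fuzzy_random_variable_def)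
  next
    fix Y assume "Y \<in> {{A\<in>Fc. level A \<alpha> \<inter> K \<noteq> {}} | \<alpha> K. \<alpha> \<in> {0..1} \<and> (K::(real^'n) set) \<in> Kc}"
    then obtain \<alpha> K where Y: "Y = {A\<in>Fc. level A \<alpha> \<inter> K \<noteq> {}}" "\<alpha> \<in> {0..1}" "K \<in> Kc" by blast
    have "X -` Y \<inter> space P = {\<omega>\<in>space P. level (X \<omega>) \<alpha> \<inter> K \<noteq> {}}"
      using X Y by (auto simp: fuzzy_random_variable_def)
    then show "X -` Y \<inter> space P \<in> sets P"
      using X Y by (simp add: fuzzy_random_variable_def random_compact_set_def)
  qed auto
next
  assume X: "X \<in> measurable P fuzzy_space"
  have F: "X \<omega> \<in> Fc" if "\<omega> \<in> space P" for \<omega>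
    using measurable_space[OF X that] by (simp add: fuzzy_space_def space_measure_of_conv)
  have "{\<omega>\<in>space P. level (X \<omega>) \<alpha> \<inter> K \<noteq> {}} \<in> sets P"
    if "\<alpha> \<in> {0..1}" "K \<in> Kc" for \<alpha> K
  proof -
    have "{A\<in>Fc. level A \<alpha> \<inter> K \<noteq> {}} \<in> sets fuzzy_space"
      unfolding fuzzy_space_def using that by (subst sets_measure_of) (auto intro!: sigma_sets.Basic)
    from measurable_sets[OF X this] show ?thesis
      using F by (auto elim!: back_subst[of "\<lambda>S. S \<in> sets P"])
  qed
  with F show "fuzzy_random_variable P X"
    by (auto simp: fuzzy_random_variable_def random_compact_set_def Fc_def)
qed

lemma independent_copies:
  fixes X :: "'w \<Rightarrow> real ^ 'n \<Rightarrow> real"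
  assumes P: "prob_space P" and X: "fuzzy_random_variable P X"
  shows "prob_space (copies_space TYPE('n) P)"
    and "prob_space.indep_vars (copies_space TYPE('n) P) (\<lambda>_. fuzzy_space)
           (\<lambda>i \<omega>. X (\<omega> i)) (copy_index TYPE('n))"
    and "i \<in> copy_index TYPE('n) \<Longrightarrow>
           distr (copies_space TYPE('n) P) fuzzy_space (\<lambda>\<omega>. X (\<omega> i)) = distr P fuzzy_space X"
proof -
  let ?I = "copy_index TYPE('n)" and ?N = "copies_space TYPE('n) P"
  interpret P: prob_space P by (rule P)
  have X'[measurable]: "X \<in> measurable P fuzzy_space"
    using X by (simp add: fuzzy_random_variable_iff_measurable)
  show N: "prob_space ?N" unfolding copies_space_def by (intro prob_space_PiM P)
  interpret N: prob_space ?N by (rule N)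
  have I: "?I \<noteq> {}" "finite ?I" by (auto simp: copy_index_def)
  have d: "distr ?N P (\<lambda>\<omega>. \<omega> i) = P" if "i \<in> ?I" for i
    unfolding copies_space_def using P that by (intro distr_PiM_component) auto
  have c: "(\<lambda>\<omega>. \<omega> i) \<in> measurable ?N P" if "i \<in> ?I" for i
    unfolding copies_space_def using that by measurable
  have "N.indep_vars (\<lambda>_. P) (\<lambda>i \<omega>. \<omega> i) ?I"
  proof (subst N.indep_vars_iff_distr_eq_PiM'[OF I(1) c])
    have "distr ?N (\<Pi>\<^sub>M i\<in>?I. P) (\<lambda>x. \<lambda>i\<in>?I. x i) = distr ?N (\<Pi>\<^sub>M i\<in>?I. P) (\<lambda>x. x)"
      by (intro distr_cong) (auto simp: copies_space_def space_PiM)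
    also have "\<dots> = ?N" by (simp add: copies_space_def)
    also have "\<dots> = (\<Pi>\<^sub>M i\<in>?I. distr ?N P (\<lambda>\<omega>. \<omega> i))"
      unfolding copies_space_def[of _ P] using d by (intro PiM_cong) (auto simp: copies_space_def)
    finally show "distr ?N (\<Pi>\<^sub>M i\<in>?I. P) (\<lambda>x. \<lambda>i\<in>?I. x i) = (\<Pi>\<^sub>M i\<in>?I. distr ?N P (\<lambda>\<omega>. \<omega> i))" .
  qed
  then show "N.indep_vars (\<lambda>_. fuzzy_space) (\<lambda>i \<omega>. X (\<omega> i)) ?I"
    by (rule N.indep_vars_compose2) simp
  show "distr ?N fuzzy_space (\<lambda>\<omega>. X (\<omega> i)) = distr P fuzzy_space X" if "i \<in> ?I"
    using distr_distr[OF X' c[OF that]] d[OF that] by (simp add: comp_def)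
qed

end

theory Submission
  imports Defs
begin

text \<open>Affine equivariance holds because the events defining the two depths coincide: the support
  function of \<open>M \<cdot> C + B\<close> at \<open>u\<close> is \<open>s\<^sub>C(M\<^sup>T u) + s\<^sub>B(u)\<close>, and by positive homogeneity the event
  may be tested at all \<open>u \<noteq> 0\<close>, a set that \<open>M\<^sup>T\<close> permutes. For the two limits, let \<open>H\<close> be a finite random
  variable that dominates the norms of all points of the \<open>0\<close>-levels of all \<open>p + 1\<close> copies. On the event defining
  the depth of \<open>A\<close> one has \<open>\<bar>s\<^sub>A\<bar> \<le> H\<close> everywhere, so the depth is at most \<open>P(H > n)\<close> as soon as
  \<open>\<bar>s\<^sub>A\<bar>\<close> exceeds \<open>n\<close> somewhere.\<close>

section \<open>Levels and support functions\<close>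

lemma FcD:
  assumes "A \<in> Fc"
  shows "0 \<le> A x" "A x \<le> 1"
  using assms by (auto simp: Fc_def)

lemma level_Fc:
  assumes "A \<in> Fc" "\<alpha> \<in> {0..1}"
  shows "level A \<alpha> \<noteq> {}" "compact (level A \<alpha>)" "convex (level A \<alpha>)"
  using assms by (auto simp: Fc_def Kc_def)

lemma level_subset_level_0:
  assumes "\<alpha> \<in> {0..1}"
  shows "level A \<alpha> \<subseteq> level A 0"
proof (cases "\<alpha> = 0")
  case False
  with assms have "level A \<alpha> \<subseteq> {x. A x > 0}" by (auto simp: level_def)
  also have "\<dots> \<subseteq> level A 0" by (simp add: level_def closure_subset)
  finally show ?thesis .
qed simp

lemma supp_eqI:
  assumes "v \<in> level A \<alpha>" "u \<bullet> v = s" "\<And>w. w \<in> level A \<alpha> \<Longrightarrow> u \<bullet> w \<le> s"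
  shows "supp A u \<alpha> = s"
  unfolding supp_def using assms by (intro cSup_eq_maximum) auto

text \<open>Compactness of the level turns the supremum into a maximum. Later computations with
  support functions work with a maximiser \<open>v\<close>, so no boundedness of suprema has to be
  discussed again.\<close>

lemma supp_attained:
  assumes "A \<in> Fc" "\<alpha> \<in> {0..1}"
  obtains v where "v \<in> level A \<alpha>" "u \<bullet> v = supp A u \<alpha>"
    "\<And>w. w \<in> level A \<alpha> \<Longrightarrow> u \<bullet> w \<le> supp A u \<alpha>"
proof -
  have "continuous_on (level A \<alpha>) (\<lambda>v. u \<bullet> v)" by (intro continuous_intros)
  from continuous_attains_sup[OF level_Fc(2,1)[OF assms] this]
  obtain v where v: "v \<in> level A \<alpha>" "\<And>w. w \<in> level A \<alpha> \<Longrightarrow> u \<bullet> w \<le> u \<bullet> v" by blast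
  then have "supp A u \<alpha> = u \<bullet> v" by (intro supp_eqI) auto
  with v that show thesis by metis
qed

lemma inner_le_supp:
  assumes "A \<in> Fc" "\<alpha> \<in> {0..1}" "w \<in> level A \<alpha>"
  shows "u \<bullet> w \<le> supp A u \<alpha>"
  using supp_attained[OF assms(1,2)] assms(3) by metis

text \<open>A maximiser for the direction \<open>u\<close> is also one for
  \<open>c *\<^sub>R u\<close>, since multiplying by \<open>c \<ge> 0\<close> preserves the
  inequalities.\<close>

lemma supp_scale_direction:
  assumes "A \<in> Fc" "\<alpha> \<in> {0..1}" "c \<ge> 0"
  shows "supp A (c *\<^sub>R u) \<alpha> = c * supp A u \<alpha>"
proof -
  obtain v where v: "v \<in> level A \<alpha>" "u \<bullet> v = supp A u \<alpha>"
    "\<And>w. w \<in> level A \<alpha> \<Longrightarrow> u \<bullet> w \<le> supp A u \<alpha>"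
    using supp_attained[OF assms(1,2)] by metis
  show ?thesis by (rule supp_eqI[OF v(1)]) (use v assms(3) in \<open>auto intro: mult_left_mono\<close>)
qed

lemma abs_supp_le:
  assumes A: "A \<in> Fc" and \<alpha>: "\<alpha> \<in> {0..1}" and u: "norm u = 1" and R: "\<And>v. v \<in> level A 0 \<Longrightarrow> norm v \<le> R"
  shows "\<bar>supp A u \<alpha>\<bar> \<le> R"
proof -
  obtain v where v: "v \<in> level A \<alpha>" "u \<bullet> v = supp A u \<alpha>"
    using supp_attained[OF A \<alpha>] by metis
  have "\<bar>u \<bullet> v\<bar> \<le> norm u * norm v" by (rule Cauchy_Schwarz_ineq2)
  also have "\<dots> \<le> R" using R level_subset_level_0[OF \<alpha>] v(1) u by auto
  finally show ?thesis by (simp add: v)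
qed

text \<open>Testing the level in the direction of \<open>v\<close> itself gives
  \<open>sgn v \<bullet> v = norm v\<close>. In this way a point far from the origin yields a
  direction in which the support function is large.\<close>

lemma norm_le_supp_sgn:
  assumes "A \<in> Fc" "v \<in> level A 0"
  shows "norm v \<le> supp A (sgn v) 0"
proof -
  have "norm v = sgn v \<bullet> v"
    by (cases "v = 0") (simp_all add: sgn_div_norm power2_norm_eq_inner[symmetric] power2_eq_square)
  also have "\<dots> \<le> supp A (sgn v) 0" using assms by (intro inner_le_supp) auto
  finally show ?thesis .
qed

section \<open>Operations on fuzzy sets\<close>

text \<open>For \<alpha> different from 0 this is a change of variables. At \<alpha> = 0 it also
  uses that an injective linear map of a finite-dimensional space commutes with closure. Both
  positive scaling and invertible matrices are instances.\<close>

lemma level_comp_linear_bij: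
  fixes f g :: "real ^ 'n \<Rightarrow> real ^ 'n"
  assumes f: "linear f" and fg: "\<And>x. f (g x) = x" and gf: "\<And>x. g (f x) = x"
  shows "level (\<lambda>t. A (g t)) \<alpha> = f ` level A \<alpha>"
proof -
  have im: "{x. Q (g x)} = f ` {x. Q x}" for Q
  proof (intro equalityI subsetI)
    fix x assume "x \<in> {x. Q (g x)}"
    then show "x \<in> f ` {x. Q x}" by (intro image_eqI[of _ _ "g x"]) (simp_all add: fg)
  qed (auto simp: gf)
  have "inj f" using gf by (metis injI)
  then have "closure (f ` S) = f ` closure S" for S
    using f by (rule closure_injective_linear_image[symmetric, rotated])
  then show ?thesis
    by (simp add: level_def im[of "\<lambda>x. 0 < A x"] im[of "\<lambda>x. \<alpha> \<le> A x"])
qed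

lemma Fc_comp_linear_bij:
  fixes f g :: "real ^ 'n \<Rightarrow> real ^ 'n"
  assumes "A \<in> Fc" "linear f" "\<And>x. f (g x) = x" "\<And>x. g (f x) = x"
  shows "(\<lambda>t. A (g t)) \<in> Fc"
proof -
  have "level (\<lambda>t. A (g t)) \<alpha> \<in> Kc" if "\<alpha> \<in> {0..1}" for \<alpha>
    unfolding level_comp_linear_bij[OF assms(2-4)] Kc_def
    using level_Fc[OF assms(1) that] assms(2)
    by (auto intro!: compact_continuous_image convex_linear_image linear_continuous_on
        simp: linear_conv_bounded_linear)
  with assms(1) show ?thesis by (auto simp: Fc_def)
qed

lemma fuzzy_scale_Fc:
  assumes "A \<in> Fc" "\<gamma> > 0"
  shows "\<gamma> \<cdot>\<^sub>F A \<in> Fc"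
  using Fc_comp_linear_bij[of A "\<lambda>x. \<gamma> *\<^sub>R x" "\<lambda>x. x /\<^sub>R \<gamma>"] assms
  by (simp add: fuzzy_scale_def linear_iff scaleR_add_right)

lemma supp_fuzzy_scale:
  assumes A: "A \<in> Fc" and \<alpha>: "\<alpha> \<in> {0..1}" and \<gamma>: "\<gamma> > 0"
  shows "supp (\<gamma> \<cdot>\<^sub>F A) u \<alpha> = \<gamma> * supp A u \<alpha>"
proof -
  have l: "level (\<gamma> \<cdot>\<^sub>F A) \<alpha> = (\<lambda>x. \<gamma> *\<^sub>R x) ` level A \<alpha>"
    using level_comp_linear_bij[of "\<lambda>x. \<gamma> *\<^sub>R x" "\<lambda>x. x /\<^sub>R \<gamma>" A] \<gamma>
    by (simp add: fuzzy_scale_def linear_iff scaleR_add_right)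
  have "supp (\<gamma> \<cdot>\<^sub>F A) u \<alpha> = supp A (\<gamma> *\<^sub>R u) \<alpha>"
    unfolding supp_def l image_image by simp
  then show ?thesis using supp_scale_direction[OF A \<alpha>, of \<gamma>] \<gamma> by simp
qed

text \<open>The fibre of \<open>M\<close> over \<open>t\<close> is the single point
  \<open>N *v t\<close>, and the inserted \<open>0\<close> cannot exceed \<open>A (N *v t)\<close>
  because membership values are nonnegative.\<close>

lemma fuzzy_matrix_invertible:
  fixes M N :: "real ^ 'n ^ 'n"
  assumes "A \<in> Fc" and MN: "M ** N = mat 1" "N ** M = mat 1"
  shows "M \<odot>\<^sub>F A = (\<lambda>t. A (N *v t))"
proof
  fix t
  have "{A y | y. M *v y = t} = {A (N *v t)}"
    using MN by (auto simp: matrix_vector_mul_assoc intro!: exI[of _ "N *v t"])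
  then have "(M \<odot>\<^sub>F A) t = Sup {0, A (N *v t)}"
    by (simp add: fuzzy_matrix_def)
  also have "\<dots> = A (N *v t)"
    using FcD(1)[OF assms(1)] by (intro cSup_eq_maximum) auto
  finally show "(M \<odot>\<^sub>F A) t = A (N *v t)" .
qed

text \<open>The row product \<open>u v* M\<close> is the transpose of \<open>M\<close> applied to
  \<open>u\<close>, so moving \<open>M\<close> to the other side of the inner product transfers it
  from the level to the direction.\<close>

lemma
  fixes M :: "real ^ 'n ^ 'n"
  assumes A: "A \<in> Fc" and M: "invertible M"
  shows fuzzy_matrix_Fc: "M \<odot>\<^sub>F A \<in> Fc"
    and supp_fuzzy_matrix: "supp (M \<odot>\<^sub>F A) u \<alpha> = supp A (u v* M) \<alpha>"
proof -
  obtain N where N: "M ** N = mat 1" "N ** M = mat 1"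
    using M by (auto simp: invertible_def)
  note eq = fuzzy_matrix_invertible[OF A N]
  have inv: "linear ((*v) M)" "M *v (N *v x) = x" "N *v (M *v x) = x" for x
    using N by (simp_all add: matrix_vector_mul_assoc)
  show "M \<odot>\<^sub>F A \<in> Fc"
    unfolding eq by (rule Fc_comp_linear_bij[OF A inv])
  show "supp (M \<odot>\<^sub>F A) u \<alpha> = supp A (u v* M) \<alpha>"
    unfolding supp_def eq level_comp_linear_bij[OF inv] image_image dot_lmul_matrix ..
qed

text \<open>With a strict inequality it does not matter whether the supremum is attained: a supremum
  exceeds \<open>c\<close> exactly when some member does.\<close>

lemma fuzzy_add_less_iff:
  assumes "A \<in> Fc" "B \<in> Fc"
  shows "c < (A \<oplus>\<^sub>F B) t \<longleftrightarrow> (\<exists>x y. x + y = t \<and> c < A x \<and> c < B y)"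
proof -
  have "{min (A x) (B y) | x y. x + y = t} \<noteq> {}"
    using add_0_right[of t] by blast
  moreover have "bdd_above {min (A x) (B y) | x y. x + y = t}"
    using FcD(2)[OF assms(1)] by (auto intro!: bdd_aboveI[of _ 1] min.coboundedI1)
  ultimately show ?thesis
    unfolding fuzzy_add_def by (subst less_cSup_iff) (simp, simp, force)
qed

lemma min_le_fuzzy_add:
  assumes "A \<in> Fc" "B \<in> Fc"
  shows "min (A x) (B y) \<le> (A \<oplus>\<^sub>F B) (x + y)"
proof (rule dense_le)
  fix c assume "c < min (A x) (B y)"
  then have "c < (A \<oplus>\<^sub>F B) (x + y)"
    unfolding fuzzy_add_less_iff[OF assms] by (intro exI[of _ x] exI[of _ y]) simp
  then show "c \<le> (A \<oplus>\<^sub>F B) (x + y)" by simp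
qed

text \<open>The supremum in the sum is attained: the sets of decompositions at the levels below \<open>\<alpha>\<close> are
  nested, compact and non-empty.\<close>

lemma level_fuzzy_add_pos:
  fixes A B :: "real ^ 'n \<Rightarrow> real"
  assumes A: "A \<in> Fc" and B: "B \<in> Fc" and \<alpha>: "\<alpha> \<in> {0<..1}"
  shows "level (A \<oplus>\<^sub>F B) \<alpha> = {x + y | x y. x \<in> level A \<alpha> \<and> y \<in> level B \<alpha>}"
proof (intro equalityI subsetI)
  fix t assume "t \<in> {x + y | x y. x \<in> level A \<alpha> \<and> y \<in> level B \<alpha>}"
  then obtain x y where "t = x + y" "x \<in> level A \<alpha>" "y \<in> level B \<alpha>" by blast
  with \<alpha> min_le_fuzzy_add[OF A B, of x y] show "t \<in> level (A \<oplus>\<^sub>F B) \<alpha>"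
    by (auto simp: level_def)
next
  fix t assume "t \<in> level (A \<oplus>\<^sub>F B) \<alpha>"
  with \<alpha> have t: "\<alpha> \<le> (A \<oplus>\<^sub>F B) t" by (auto simp: level_def)
  \<comment> \<open>The levels \<open>a n\<close> increase to \<alpha>. The shift by 2 keeps
    \<open>a 0\<close> positive, so that every \<open>level A (a n)\<close> is a superlevel set and
    not the closure used at level 0.\<close>
  define a where "a n = \<alpha> - \<alpha> / real (n + 2)" for n
  have a: "0 < a n" "a n < \<alpha>" "a n \<in> {0..1}" for n
  proof -
    have "0 < \<alpha> / real (n + 2)" "\<alpha> / real (n + 2) < \<alpha>"
      using \<alpha> by (auto simp: field_simps intro: add_pos_nonneg)
    with \<alpha> show "0 < a n" "a n < \<alpha>" "a n \<in> {0..1}" by (auto simp: a_def)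
  qed
  have a_mono: "a m \<le> a n" if "m \<le> n" for m n
    using that \<alpha> by (auto simp: a_def intro!: divide_left_mono)
  have a_lim: "a \<longlonglongrightarrow> \<alpha>"
  proof -
    have "(\<lambda>n. \<alpha> / real (n + 2)) \<longlonglongrightarrow> 0"
      by (rule LIMSEQ_ignore_initial_segment[OF lim_const_over_n])
    from tendsto_diff[OF tendsto_const[of \<alpha>] this] show ?thesis by (simp add: a_def[abs_def])
  qed
  \<comment> \<open>\<open>F n\<close> collects the \<open>x\<close> for which
    \<open>t = x + (t - x)\<close> splits \<open>t\<close> at level \<open>a n\<close>; it is the
    intersection of a compact set with the reflected copy of another.\<close>
  define F where "F n = level A (a n) \<inter> (\<lambda>y. t - y) ` level B (a n)" for n
  have F_iff: "x \<in> F n \<longleftrightarrow> a n \<le> A x \<and> a n \<le> B (t - x)" for x n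
    using a(1)[of n] by (auto simp: F_def level_def intro!: image_eqI[of _ _ "t - x"])
  have "\<Inter> (range F) \<noteq> {}"
  proof (rule compact_nest)
    show "compact (F n)" for n
      unfolding F_def using level_Fc(2)[OF A a(3)] level_Fc(2)[OF B a(3)]
      by (intro compact_Int compact_continuous_image continuous_intros)
    show "F n \<noteq> {}" for n
    proof -
      have "a n < (A \<oplus>\<^sub>F B) t" using t a(2)[of n] by simp
      then obtain x y where "x + y = t" "a n < A x" "a n < B y"
        using fuzzy_add_less_iff[OF A B] by blast
      then have "x \<in> F n" by (auto simp: F_iff)
      then show ?thesis by blast
    qed
    show "F n \<subseteq> F m" if "m \<le> n" for m n
      using a_mono[OF that] by (auto simp: F_iff)
  qed
  then obtain x where "\<And>n. x \<in> F n" by blast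
  then have x: "\<And>n. a n \<le> A x" "\<And>n. a n \<le> B (t - x)"
    by (simp_all add: F_iff)
  have "\<alpha> \<le> A x" "\<alpha> \<le> B (t - x)"
    using LIMSEQ_le_const2[OF a_lim] x by blast+
  with \<alpha> have "x \<in> level A \<alpha>" "t - x \<in> level B \<alpha>" by (auto simp: level_def)
  moreover have "t = x + (t - x)" by simp
  ultimately show "t \<in> {x + y | x y. x \<in> level A \<alpha> \<and> y \<in> level B \<alpha>}" by blast
qed

text \<open>The sets of positive membership add exactly. Taking closures, one inclusion holds for
  any two sets; the other holds because a sum of compact sets is closed.\<close>

lemma level_fuzzy_add_0:
  fixes A B :: "real ^ 'n \<Rightarrow> real"
  assumes A: "A \<in> Fc" and B: "B \<in> Fc"
  shows "level (A \<oplus>\<^sub>F B) 0 = {x + y | x y. x \<in> level A 0 \<and> y \<in> level B 0}"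
proof -
  let ?S = "{x. A x > 0}" and ?T = "{x. B x > 0}"
  have pos: "{t. (A \<oplus>\<^sub>F B) t > 0} = ?S + ?T"
    by (auto simp: fuzzy_add_less_iff[OF A B] set_plus_def)
  have sums: "closure ?S + closure ?T = {x + y | x y. x \<in> closure ?S \<and> y \<in> closure ?T}"
    by (auto simp: set_plus_def)
  have "compact (closure ?S)" "compact (closure ?T)"
    using level_Fc(2)[OF A, of 0] level_Fc(2)[OF B, of 0] by (auto simp: level_def)
  then have "closed (closure ?S + closure ?T)"
    unfolding sums by (intro compact_imp_closed compact_sums)
  then have "closure (?S + ?T) \<subseteq> closure ?S + closure ?T"
    by (intro closure_minimal set_plus_mono2 closure_subset)
  with closure_sum[of ?S ?T] show ?thesis
    by (simp add: level_def pos sums)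
qed

lemma level_fuzzy_add:
  fixes A B :: "real ^ 'n \<Rightarrow> real"
  assumes "A \<in> Fc" "B \<in> Fc" "\<alpha> \<in> {0..1}"
  shows "level (A \<oplus>\<^sub>F B) \<alpha> = {x + y | x y. x \<in> level A \<alpha> \<and> y \<in> level B \<alpha>}"
  using level_fuzzy_add_pos[OF assms(1,2), of \<alpha>] level_fuzzy_add_0[OF assms(1,2)] assms(3)
  by (cases "\<alpha> = 0") auto

text \<open>Maximisers in the two levels add up to a maximiser in their Minkowski sum.\<close>

lemma supp_fuzzy_add:
  fixes A B :: "real ^ 'n \<Rightarrow> real"
  assumes A: "A \<in> Fc" and B: "B \<in> Fc" and \<alpha>: "\<alpha> \<in> {0..1}"
  shows "supp (A \<oplus>\<^sub>F B) u \<alpha> = supp A u \<alpha> + supp B u \<alpha>"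
proof -
  obtain v where v: "v \<in> level A \<alpha>" "u \<bullet> v = supp A u \<alpha>"
    using supp_attained[OF A \<alpha>] by metis
  obtain w where w: "w \<in> level B \<alpha>" "u \<bullet> w = supp B u \<alpha>"
    using supp_attained[OF B \<alpha>] by metis
  have "v + w \<in> level (A \<oplus>\<^sub>F B) \<alpha>"
    using v w by (auto simp: level_fuzzy_add[OF assms])
  then show ?thesis
    by (rule supp_eqI)
      (auto simp: v w inner_add_right level_fuzzy_add[OF assms]
        intro!: add_mono inner_le_supp[OF A \<alpha>] inner_le_supp[OF B \<alpha>])
qed

section \<open>Affine equivariance\<close>

text \<open>Over a finite nonempty index set, lying between minimum and maximum means being above
  one of the values and below one of them. In this form common summands cancel and positive factors
  drop out.\<close>

lemma min_max_supp_iff: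
  fixes X :: "'w \<Rightarrow> real ^ 'n \<Rightarrow> real"
  shows "s \<in> {min_supp X \<omega> u \<alpha> .. max_supp X \<omega> u \<alpha>} \<longleftrightarrow>
    (\<exists>i\<in>copy_index TYPE('n). supp (X (\<omega> i)) u \<alpha> \<le> s) \<and>
    (\<exists>i\<in>copy_index TYPE('n). s \<le> supp (X (\<omega> i)) u \<alpha>)"
proof -
  have "finite (copy_index TYPE('n))" "copy_index TYPE('n) \<noteq> {}" by (auto simp: copy_index_def)
  then show ?thesis
    unfolding min_supp_def max_supp_def by (auto simp: Min_le_iff Max_ge_iff)
qed

text \<open>Every nonzero vector is a positive multiple of a unit vector. The passage is needed
  because an invertible matrix permutes the nonzero vectors but in general does not preserve the
  sphere.\<close>

lemma ball_sphere_iff_nonzero: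
  fixes Q :: "real ^ 'n \<Rightarrow> bool"
  assumes "\<And>c u. c > 0 \<Longrightarrow> Q (c *\<^sub>R u) \<longleftrightarrow> Q u"
  shows "(\<forall>u\<in>sphere 0 1. Q u) \<longleftrightarrow> (\<forall>u. u \<noteq> 0 \<longrightarrow> Q u)"
proof (intro iffI allI impI ballI)
  fix u :: "real ^ 'n"
  assume "\<forall>u\<in>sphere 0 1. Q u" "u \<noteq> 0"
  then show "Q u"
    using assms[of "inverse (norm u)" u] by (simp add: norm_sgn flip: sgn_div_norm)
next
  fix u :: "real ^ 'n"
  assume "\<forall>u. u \<noteq> 0 \<longrightarrow> Q u" "u \<in> sphere 0 1"
  then show "Q u" by (cases "u = 0") auto
qed

lemma depth_affine:
  fixes P :: "'w measure" and X :: "'w \<Rightarrow> real ^ 'n \<Rightarrow> real" and M :: "real ^ 'n ^ 'n"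
  assumes X: "\<And>\<omega>. \<omega> \<in> space P \<Longrightarrow> X \<omega> \<in> Fc" and M: "invertible M" and B: "B \<in> Fc" and C: "C \<in> Fc"
  shows "naive_simplicial_depth P (M \<odot>\<^sub>F C \<oplus>\<^sub>F B) (\<lambda>\<omega>. M \<odot>\<^sub>F X \<omega> \<oplus>\<^sub>F B)
    = naive_simplicial_depth P C X"
proof -
  let ?I = "copy_index TYPE('n)" and ?Y = "\<lambda>\<omega>. M \<odot>\<^sub>F X \<omega> \<oplus>\<^sub>F B"
  obtain N where N: "M ** N = mat 1" "N ** M = mat 1"
    using M by (auto simp: invertible_def)
  have MN: "(u v* M) v* N = u" "(u v* N) v* M = u" for u
    using N by (simp_all add: vector_matrix_mul_assoc)
  have supp: "supp (M \<odot>\<^sub>F A \<oplus>\<^sub>F B) u \<alpha> = supp A (u v* M) \<alpha> + supp B u \<alpha>"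
    if "A \<in> Fc" "\<alpha> \<in> {0..1}" for A u \<alpha>
    using that by (simp add: supp_fuzzy_add[OF fuzzy_matrix_Fc[OF _ M] B] supp_fuzzy_matrix[OF _ M])
  have "(\<forall>u\<in>sphere 0 1. \<forall>\<alpha>\<in>{0..1}. supp (M \<odot>\<^sub>F C \<oplus>\<^sub>F B) u \<alpha> \<in> {min_supp ?Y \<omega> u \<alpha> .. max_supp ?Y \<omega> u \<alpha>})
    \<longleftrightarrow> (\<forall>u\<in>sphere 0 1. \<forall>\<alpha>\<in>{0..1}. supp C u \<alpha> \<in> {min_supp X \<omega> u \<alpha> .. max_supp X \<omega> u \<alpha>})"
    (is "(\<forall>u\<in>_. \<forall>\<alpha>\<in>_. ?Q u \<alpha>) \<longleftrightarrow> (\<forall>u\<in>_. \<forall>\<alpha>\<in>_. ?R u \<alpha>)")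
    if "\<omega> \<in> space (copies_space TYPE('n) P)" for \<omega>
  proof -
    have Xi: "X (\<omega> i) \<in> Fc" if "i \<in> ?I" for i
      using that \<open>\<omega> \<in> _\<close> by (intro X) (auto simp: copies_space_def space_PiM)
    \<comment> \<open>The matrix acts on directions only, so \<alpha> can be fixed while
      \<open>u\<close> varies.\<close>
    have "(\<forall>u\<in>sphere 0 1. ?Q u \<alpha>) \<longleftrightarrow> (\<forall>u\<in>sphere 0 1. ?R u \<alpha>)" if \<alpha>: "\<alpha> \<in> {0..1}" for \<alpha>
    proof -
      \<comment> \<open>The summand \<open>supp B u \<alpha>\<close> occurs on both sides of every
        inequality and cancels.\<close>
      have QR: "?Q u \<alpha> \<longleftrightarrow> ?R (u v* M) \<alpha>" for u
        unfolding min_max_supp_iff supp[OF C \<alpha>] using supp[OF Xi \<alpha>] by simp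
      have R_scale: "?R (c *\<^sub>R u) \<alpha> \<longleftrightarrow> ?R u \<alpha>" if "c > 0" for c u
        unfolding min_max_supp_iff using Xi C \<alpha> that
        by (simp add: supp_scale_direction cong: bex_cong)
      have nz: "u v* M = 0 \<longleftrightarrow> u = 0" for u
        by (metis MN(1) vector_matrix_mult_0)
      have "(\<forall>u\<in>sphere 0 1. ?R u \<alpha>) \<longleftrightarrow> (\<forall>u. u \<noteq> 0 \<longrightarrow> ?R u \<alpha>)"
        by (rule ball_sphere_iff_nonzero) (rule R_scale)
      \<comment> \<open>Substitution along the bijection \<open>u v* M\<close> of the nonzero
        vectors, whose inverse is \<open>u v* N\<close>.\<close>
      also have "\<dots> \<longleftrightarrow> (\<forall>u. u \<noteq> 0 \<longrightarrow> ?R (u v* M) \<alpha>)"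
        by (metis MN(2) nz)
      also have "\<dots> \<longleftrightarrow> (\<forall>u\<in>sphere 0 1. ?R (u v* M) \<alpha>)"
        by (rule ball_sphere_iff_nonzero[symmetric])
          (simp only: scaleR_vector_matrix_assoc R_scale)
      also have "\<dots> \<longleftrightarrow> (\<forall>u\<in>sphere 0 1. ?Q u \<alpha>)"
        by (simp only: QR)
      finally show ?thesis by (rule sym)
    qed
    then show ?thesis by blast
  qed
  then show ?thesis
    unfolding naive_simplicial_depth_def
    by (intro arg_cong[where f="measure _"] Collect_cong conj_cong refl)
qed

section \<open>Vanishing of the depth\<close>

text \<open>As the supremum is attained, it is at least \<open>c\<close> exactly when the level
  meets the half-space \<open>{v. c \<le> u \<bullet> v}\<close>. Random compact sets are tested on
  compact sets only, so the half-space is exhausted by its intersections \<open>K n\<close> with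
  balls.\<close>

lemma borel_measurable_supp:
  fixes X :: "'w \<Rightarrow> real ^ 'n \<Rightarrow> real"
  assumes X: "fuzzy_random_variable P X" and \<alpha>: "\<alpha> \<in> {0..1}"
  shows "(\<lambda>\<omega>. supp (X \<omega>) u \<alpha>) \<in> borel_measurable P"
proof (rule borel_measurable_iff_ge[THEN iffD2], rule allI)
  fix c :: real
  define K where "K n = cball 0 (real n) \<inter> {v. c \<le> u \<bullet> v}" for n :: nat
  have F: "X \<omega> \<in> Fc" if "\<omega> \<in> space P" for \<omega>
    using X that by (simp add: fuzzy_random_variable_def)
  have "{\<omega> \<in> space P. c \<le> supp (X \<omega>) u \<alpha>} = (\<Union>n. {\<omega> \<in> space P. level (X \<omega>) \<alpha> \<inter> K n \<noteq> {}})"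
  proof (intro equalityI subsetI)
    fix \<omega> assume \<omega>: "\<omega> \<in> {\<omega> \<in> space P. c \<le> supp (X \<omega>) u \<alpha>}"
    then obtain v where v: "v \<in> level (X \<omega>) \<alpha>" "u \<bullet> v = supp (X \<omega>) u \<alpha>"
      using supp_attained[OF F \<alpha>] by blast
    obtain n where "norm v \<le> real n" using real_arch_simple by blast
    with v \<omega> have "v \<in> level (X \<omega>) \<alpha> \<inter> K n" by (simp add: K_def)
    with \<omega> show "\<omega> \<in> (\<Union>n. {\<omega> \<in> space P. level (X \<omega>) \<alpha> \<inter> K n \<noteq> {}})" by blast
  next
    fix \<omega> assume "\<omega> \<in> (\<Union>n. {\<omega> \<in> space P. level (X \<omega>) \<alpha> \<inter> K n \<noteq> {}})"
    then obtain v where v: "\<omega> \<in> space P" "v \<in> level (X \<omega>) \<alpha>" "c \<le> u \<bullet> v" by (auto simp: K_def)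
    with inner_le_supp[OF F \<alpha>] show "\<omega> \<in> {\<omega> \<in> space P. c \<le> supp (X \<omega>) u \<alpha>}"
      by (auto intro: order_trans)
  qed
  moreover have "{\<omega> \<in> space P. level (X \<omega>) \<alpha> \<inter> K n \<noteq> {}} \<in> sets P" for n
  \<comment> \<open>The empty set is not in \<open>Kc\<close>; if \<open>K n\<close> is empty, then
    so is the event.\<close>
  proof (cases "K n = {}")
    case False
    then have "K n \<in> Kc"
      unfolding Kc_def K_def
      by (auto intro!: compact_Int_closed closed_halfspace_ge convex_Int convex_halfspace_ge)
    with X \<alpha> show ?thesis by (auto simp: fuzzy_random_variable_def random_compact_set_def)
  qed simp
  ultimately show "{\<omega> \<in> space P. c \<le> supp (X \<omega>) u \<alpha>} \<in> sets P" by auto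
qed

text \<open>A bound for the norms on the \<open>0\<close>-level built from finitely many values of
  the support function, so that its measurability along a fuzzy random variable is
  immediate.\<close>

definition level_bound :: "(real ^ 'n \<Rightarrow> real) \<Rightarrow> real" where
  "level_bound A = (\<Sum>e\<in>Basis. \<bar>supp A e 0\<bar> + \<bar>supp A (- e) 0\<bar>)"

text \<open>Each coordinate \<open>v \<bullet> e\<close> lies between
  \<open>- supp A (- e) 0\<close> and \<open>supp A e 0\<close>, and the Euclidean norm is at most
  the sum of the absolute coordinates.\<close>

lemma norm_le_level_bound:
  assumes "A \<in> Fc" "v \<in> level A 0"
  shows "norm v \<le> level_bound A"
proof -
  have "norm v \<le> (\<Sum>e\<in>Basis. \<bar>v \<bullet> e\<bar>)" by (rule norm_le_l1)
  also have "\<dots> \<le> level_bound A"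
    unfolding level_bound_def
  proof (rule sum_mono)
    fix e :: "real ^ 'a"
    have "e \<bullet> v \<le> supp A e 0" "(- e) \<bullet> v \<le> supp A (- e) 0"
      using assms by (intro inner_le_supp; simp)+
    then show "\<bar>v \<bullet> e\<bar> \<le> \<bar>supp A e 0\<bar> + \<bar>supp A (- e) 0\<bar>"
      by (simp add: inner_commute)
  qed
  finally show ?thesis .
qed

lemma level_bound_nonneg: "0 \<le> level_bound A"
  unfolding level_bound_def by (intro sum_nonneg) auto

text \<open>The common core of both limits, stated for an arbitrary filter so that it covers the
  real parameter of a ray as well as the index of a sequence.\<close>

lemma depth_tendsto_0:
  fixes P :: "'w measure" and X :: "'w \<Rightarrow> real ^ 'n \<Rightarrow> real" and A :: "'b \<Rightarrow> real ^ 'n \<Rightarrow> real"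
  assumes P: "prob_space P" and X: "fuzzy_random_variable P X"
    and s: "filterlim s at_top F"
    and u: "eventually (\<lambda>k. \<exists>u\<in>sphere 0 1. s k \<le> supp (A k) u 0) F"
  shows "((\<lambda>k. naive_simplicial_depth P (A k) X) \<longlongrightarrow> 0) F"
proof -
  let ?I = "copy_index TYPE('n)" and ?N = "copies_space TYPE('n) P"
  interpret N: prob_space ?N by (rule independent_copies(1)[OF P X])
  have I: "finite ?I" by (simp add: copy_index_def)
  have XF: "X (\<omega> i) \<in> Fc" if "\<omega> \<in> space ?N" "i \<in> ?I" for \<omega> i
    using X that by (auto simp: fuzzy_random_variable_def copies_space_def space_PiM)
  \<comment> \<open>The summands are nonnegative, so the sum dominates the bound of each single
    copy.\<close>
  define H where "H \<omega> = (\<Sum>i\<in>?I. level_bound (X (\<omega> i)))" for \<omega>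
  have [measurable]: "(\<lambda>\<omega>. level_bound (X \<omega>)) \<in> borel_measurable P"
    unfolding level_bound_def using borel_measurable_supp[OF X] by measurable
  have [measurable]: "H \<in> borel_measurable ?N"
    unfolding H_def copies_space_def by measurable
  define T where "T n = {\<omega> \<in> space ?N. real n < H \<omega>}" for n
  have T[measurable]: "T n \<in> sets ?N" for n unfolding T_def by measurable
  \<comment> \<open>The sets \<open>T n\<close> decrease, and their intersection is empty because
    \<open>H\<close> takes finite values; continuity from above applies.\<close>
  have "(\<lambda>n. measure ?N (T n)) \<longlonglongrightarrow> measure ?N (\<Inter>n. T n)"
    by (rule N.finite_Lim_measure_decseq) (auto simp: T_def decseq_def)
  also have "(\<Inter>n. T n) = {}"
  proof -
    have "\<omega> \<notin> (\<Inter>n. T n)" for \<omega>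
      using real_arch_simple[of "H \<omega>"] by (auto simp: T_def not_less)
    then show ?thesis by blast
  qed
  finally have T_lim: "(\<lambda>n. measure ?N (T n)) \<longlonglongrightarrow> 0" by simp
  \<comment> \<open>Only the upper end of the interval enters: \<open>supp B u 0\<close> is below
    the value of some copy, which is at most \<open>H\<close>.\<close>
  have depth_le: "naive_simplicial_depth P B X \<le> measure ?N (T n)"
    if u: "u \<in> sphere 0 1" and n: "real n < supp B u 0" for B u n
    unfolding naive_simplicial_depth_def
  proof (rule N.finite_measure_mono[OF subsetI T])
    fix \<omega> assume \<omega>: "\<omega> \<in> {\<omega> \<in> space ?N. \<forall>u\<in>sphere 0 1. \<forall>\<alpha>\<in>{0..1}.
      supp B u \<alpha> \<in> {min_supp X \<omega> u \<alpha> .. max_supp X \<omega> u \<alpha>}}"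
    with u have "supp B u 0 \<in> {min_supp X \<omega> u 0 .. max_supp X \<omega> u 0}" by simp
    then obtain i where i: "i \<in> ?I" "supp B u 0 \<le> supp (X (\<omega> i)) u 0"
      unfolding min_max_supp_iff by blast
    have "\<bar>supp (X (\<omega> i)) u 0\<bar> \<le> level_bound (X (\<omega> i))"
      using \<omega> i u XF[of \<omega> i] by (intro abs_supp_le norm_le_level_bound) auto
    also have "\<dots> \<le> H \<omega>"
      unfolding H_def using i I by (intro member_le_sum level_bound_nonneg)
    finally show "\<omega> \<in> T n" using \<omega> i n by (simp add: T_def)
  qed
  show ?thesis
  proof (rule tendstoI)
    fix \<epsilon> :: real assume "\<epsilon> > 0"
    with T_lim obtain n where n: "measure ?N (T n) < \<epsilon>"
      by (metis (mono_tags) eventually_happens' order_tendstoD(2) sequentially_bot)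
    have "eventually (\<lambda>k. real n < s k) F" using s by (simp add: filterlim_at_top_dense)
    with u show "eventually (\<lambda>k. dist (naive_simplicial_depth P (A k) X) 0 < \<epsilon>) F"
    proof eventually_elim
      case (elim k)
      then obtain u where "u \<in> sphere 0 1" "real n < supp (A k) u 0" by force
      from depth_le[OF this] n show ?case
        by (simp add: naive_simplicial_depth_def)
    qed
  qed
qed

text \<open>If the \<open>0\<close>-level contained no point but the origin, the nonempty
  \<open>1\<close>-level would force \<open>B 0 = 1\<close> while \<open>B\<close> vanishes
  elsewhere, making \<open>B\<close> the indicator of the origin. Hence there is some
  \<open>v \<noteq> 0\<close> in it, and its direction works.\<close>

lemma supp_pos_if_nonzero:
  fixes B :: "real ^ 'n \<Rightarrow> real"
  assumes B: "B \<in> Fc" and nz: "B \<noteq> indicator {0}"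
  obtains u where "u \<in> sphere 0 1" "supp B u 0 > 0"
proof -
  have "\<exists>v\<in>level B 0. v \<noteq> 0"
  proof (rule ccontr)
    assume "\<not> ?thesis"
    then have 0: "level B 0 \<subseteq> {0}" by auto
    obtain x where x: "x \<in> level B 1" using level_Fc(1)[OF B, of 1] by auto
    with 0 level_subset_level_0[of 1 B] have "x = 0" by auto
    with x FcD(2)[OF B, of 0] have "B 0 = 1" by (simp add: level_def)
    moreover have "B y = 0" if "y \<noteq> 0" for y
    proof -
      have "y \<notin> {x. B x > 0}" using 0 that closure_subset[of "{x. B x > 0}"] by (auto simp: level_def)
      with FcD(1)[OF B, of y] show ?thesis by simp
    qed
    ultimately have "B = indicator {0}" by (auto simp: fun_eq_iff indicator_def)
    with nz show False by simp
  qed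
  then obtain v where v: "v \<in> level B 0" "v \<noteq> 0" by blast
  with norm_le_supp_sgn[OF B v(1)] have "supp B (sgn v) 0 > 0"
    by (smt (verit) zero_less_norm_iff)
  with v show thesis by (intro that[of "sgn v"]) (simp_all add: norm_sgn)
qed

text \<open>In a fixed direction where \<open>B\<close> has positive support value, the support
  function along the ray is affine in \<open>l\<close> with positive slope.\<close>

lemma depth_ray_tendsto_0:
  fixes P :: "'w measure" and X :: "'w \<Rightarrow> real ^ 'n \<Rightarrow> real"
  assumes "prob_space P" "fuzzy_random_variable P X"
    and A: "A \<in> Fc" and B: "B \<in> Fc" "B \<noteq> indicator {0}"
  shows "((\<lambda>l :: real. naive_simplicial_depth P (A \<oplus>\<^sub>F l \<cdot>\<^sub>F B) X) \<longlongrightarrow> 0) at_top"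
proof -
  obtain u where u: "u \<in> sphere 0 1" "supp B u 0 > 0"
    using supp_pos_if_nonzero[OF B] by blast
  show ?thesis
  proof (rule depth_tendsto_0[OF assms(1,2)])
    show "filterlim (\<lambda>l. supp A u 0 + l * supp B u 0) at_top at_top"
      using u(2)
      by (intro filterlim_tendsto_add_at_top[OF tendsto_const]
          filterlim_at_top_mult_tendsto_pos[OF tendsto_const _ filterlim_ident])
    \<comment> \<open>Restricting to \<open>l > 0\<close> makes the rule for positive scaling
      applicable.\<close>
    show "\<forall>\<^sub>F l in at_top. \<exists>w\<in>sphere 0 1. supp A u 0 + l * supp B u 0 \<le> supp (A \<oplus>\<^sub>F l \<cdot>\<^sub>F B) w 0"
      using eventually_gt_at_top[of 0]
    proof eventually_elim
      case (elim l)
      have "supp (A \<oplus>\<^sub>F l \<cdot>\<^sub>F B) u 0 = supp A u 0 + l * supp B u 0"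
        using elim by (simp add: supp_fuzzy_add[OF A fuzzy_scale_Fc[OF B(1)]] supp_fuzzy_scale[OF B(1)])
      with u(1) show ?case by (intro bexI[of _ u]) simp_all
    qed
  qed
qed

section \<open>Comparison of the metrics with the size of the levels\<close>

text \<open>By the triangle inequality \<open>R + S\<close> bounds every single distance. This
  bounds the infima and suprema, and also provides the boundedness that makes the real supremum an
  upper bound in the proof of nonnegativity.\<close>

lemma hausdorff_dist_bounds:
  fixes K L :: "(real ^ 'n) set"
  assumes "K \<noteq> {}" "L \<noteq> {}"
    and R: "\<And>x. x \<in> K \<Longrightarrow> norm x \<le> R" and S: "\<And>y. y \<in> L \<Longrightarrow> norm y \<le> S"
  shows "0 \<le> hausdorff_dist K L" "hausdorff_dist K L \<le> R + S"
proof -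
  have d: "dist x y \<le> R + S" if "x \<in> K" "y \<in> L" for x y
    using norm_triangle_ineq4[of x y] R[OF that(1)] S[OF that(2)] by (simp add: dist_norm)
  obtain k l where kl: "k \<in> K" "l \<in> L" using assms(1,2) by blast
  have K: "(INF y\<in>L. dist x y) \<le> R + S" if "x \<in> K" for x
  proof -
    have "(INF y\<in>L. dist x y) \<le> dist x l"
      by (rule cINF_lower) (auto intro!: kl bdd_belowI[of _ 0])
    also have "\<dots> \<le> R + S" by (rule d[OF that kl(2)])
    finally show ?thesis .
  qed
  have L: "(INF x\<in>K. dist x y) \<le> R + S" if "y \<in> L" for y
  proof -
    have "(INF x\<in>K. dist x y) \<le> dist k y"
      by (rule cINF_lower) (auto intro!: kl bdd_belowI[of _ 0])
    also have "\<dots> \<le> R + S" by (rule d[OF kl(1) that])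
    finally show ?thesis .
  qed
  show "hausdorff_dist K L \<le> R + S"
    unfolding hausdorff_dist_def using assms(1,2) K L by (intro max.boundedI cSUP_least)
  have "0 \<le> (INF y\<in>L. dist k y)" using assms(2) by (intro cINF_greatest) auto
  also have "\<dots> \<le> (SUP x\<in>K. INF y\<in>L. dist x y)"
    using K by (intro cSUP_upper kl(1)) (auto intro!: bdd_aboveI[of _ "R + S"])
  finally show "0 \<le> hausdorff_dist K L" by (simp add: hausdorff_dist_def)
qed

text \<open>A non-integrable \<open>f\<close> has Bochner integral \<open>0\<close>, so the bounds hold for it as well.\<close>

lemma set_integral_le_const:
  fixes f :: "'a \<Rightarrow> real"
  assumes S: "S \<in> sets M" "emeasure M S \<le> 1"
    and f: "\<And>x. x \<in> S \<Longrightarrow> 0 \<le> f x" "\<And>x. x \<in> S \<Longrightarrow> f x \<le> c" and "0 \<le> c"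
  shows "(LINT x:S|M. f x) \<in> {0..c}"
proof -
  have fin: "emeasure M S < \<infinity>" using S(2) by (rule order_le_less_trans) simp
  have "(LINT x:S|M. f x) \<le> c"
  proof (cases "set_integrable M S f")
    case True
    have "(LINT x:S|M. f x) \<le> (LINT x:S|M. c)"
      using S fin True f by (intro set_integral_mono) (auto simp: set_integrable_def)
    also have "\<dots> = c * measure M S"
      using S fin by (simp add: set_lebesgue_integral_def)
    also have "\<dots> \<le> c * 1"
      using S(2) \<open>0 \<le> c\<close> by (intro mult_left_mono) (auto simp: measure_def intro: enn2real_leI)
    finally show ?thesis by simp
  next
    case False
    then show ?thesis
      using \<open>0 \<le> c\<close> by (simp add: set_integrable_def set_lebesgue_integral_def not_integrable_integral_eq)
  qed
  moreover have "0 \<le> (LINT x:S|M. f x)"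
    using f(1) by (auto simp: set_lebesgue_integral_def indicator_def intro!: integral_nonneg)
  ultimately show ?thesis by simp
qed

text \<open>The last step for both integral metrics: an integral bounded by \<open>c powr r\<close>
  has \<open>r\<close>-th root at most \<open>c\<close>.\<close>

lemma powr_root_le:
  fixes a c r :: real
  assumes "a \<in> {0..c powr r}" "0 \<le> c" "1 \<le> r"
  shows "a powr (1 / r) \<le> c"
proof -
  have "a powr (1 / r) \<le> (c powr r) powr (1 / r)"
    using assms by (intro powr_mono2) auto
  also have "\<dots> = c" using assms by (simp add: powr_powr)
  finally show ?thesis .
qed

section \<open>Each metric is at most the sum of the radii of the two
  \<open>0\<close>-levels\<close>

context
  fixes A B :: "real ^ 'n \<Rightarrow> real" and R S :: real
  assumes A: "A \<in> Fc" and B: "B \<in> Fc"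
    and R: "\<And>v. v \<in> level A 0 \<Longrightarrow> norm v \<le> R" and S: "\<And>v. v \<in> level B 0 \<Longrightarrow> norm v \<le> S"
begin

lemma level_bounds_nonneg: "0 \<le> R" "0 \<le> S"
proof -
  obtain v w where "v \<in> level A 0" "w \<in> level B 0"
    using level_Fc(1)[OF A, of 0] level_Fc(1)[OF B, of 0] by auto
  from R[OF this(1)] S[OF this(2)] show "0 \<le> R" "0 \<le> S"
    by (auto intro: order_trans[OF norm_ge_zero])
qed

lemma hausdorff_dist_level_bounds:
  assumes \<alpha>: "\<alpha> \<in> {0..1}"
  shows "0 \<le> hausdorff_dist (level A \<alpha>) (level B \<alpha>)" "hausdorff_dist (level A \<alpha>) (level B \<alpha>) \<le> R + S"
  using hausdorff_dist_bounds[of "level A \<alpha>" "level B \<alpha>" R S] level_Fc(1)[OF A \<alpha>] level_Fc(1)[OF B \<alpha>]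
    R S level_subset_level_0[OF \<alpha>] by blast+

lemma d_inf_le: "d_inf A B \<le> R + S"
  unfolding d_inf_def using hausdorff_dist_level_bounds by (intro cSUP_least) auto

lemma d_fin_le:
  assumes r: "1 \<le> r"
  shows "d_fin r A B \<le> R + S"
  unfolding d_fin_def
  using hausdorff_dist_level_bounds level_bounds_nonneg r
  by (intro powr_root_le set_integral_le_const powr_mono2) auto

text \<open>On unit vectors the two support functions are bounded by \<open>R\<close> and
  \<open>S\<close>. Both domains of integration have mass at most 1, so the constant
  \<open>(R + S) powr r\<close> passes through the inner and the outer integral.\<close>

lemma rho_le:
  assumes r: "1 \<le> r"
  shows "rho r A B \<le> R + S"
  unfolding rho_def
proof (rule powr_root_le[OF set_integral_le_const])
  interpret H: prob_space "sphere_haar :: (real ^ 'n) measure" by (rule prob_space_sphere_haar)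
  show "sphere 0 1 \<in> sets (sphere_haar :: (real ^ 'n) measure)"
    by (simp add: sphere_haar_def)
  show "emeasure sphere_haar (sphere 0 1 :: (real ^ 'n) set) \<le> 1" by (rule H.emeasure_le_1)
  fix u :: "real ^ 'n" assume u: "u \<in> sphere 0 1"
  have "\<bar>supp A u \<alpha> - supp B u \<alpha>\<bar> \<le> R + S" if "\<alpha> \<in> {0..1}" for \<alpha>
    using abs_supp_le[OF A that _ R, of u] abs_supp_le[OF B that _ S, of u] u by simp
  then have "(LINT \<alpha>:{0..1}|lborel. \<bar>supp A u \<alpha> - supp B u \<alpha>\<bar> powr r) \<in> {0..(R + S) powr r}"
    using r by (intro set_integral_le_const powr_mono2) auto
  then show "0 \<le> (LINT \<alpha>:{0..1}|lborel. \<bar>supp A u \<alpha> - supp B u \<alpha>\<bar> powr r)"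
    and "(LINT \<alpha>:{0..1}|lborel. \<bar>supp A u \<alpha> - supp B u \<alpha>\<bar> powr r) \<le> (R + S) powr r"
    by auto
qed (use level_bounds_nonneg r in auto)

end

text \<open>Let \<open>v\<close> have largest norm in the \<open>0\<close>-level of
  \<open>A\<close>. Each metric is then at most \<open>norm v + level_bound B\<close>, so a large
  distance forces \<open>norm v\<close>, and with it the support function at \<open>sgn v\<close>,
  to be large.\<close>

lemma supp_ge_dist:
  fixes A B :: "real ^ 'n \<Rightarrow> real"
  assumes A: "A \<in> Fc" and B: "B \<in> Fc"
    and d: "d \<in> {d_fin r | r. r \<ge> 1} \<union> {d_inf} \<union> {rho r | r. r \<ge> 1}"
    and gt: "d A B > level_bound B"
  shows "\<exists>u\<in>sphere 0 1. d A B - level_bound B \<le> supp A u 0"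
proof -
  have "continuous_on (level A 0) norm" by (intro continuous_intros)
  from continuous_attains_sup[OF level_Fc(2,1)[OF A] this]
  obtain v where v: "v \<in> level A 0" "\<And>w. w \<in> level A 0 \<Longrightarrow> norm w \<le> norm v" by auto
  have "d A B \<le> norm v + level_bound B"
    using d d_fin_le[OF A B v(2) norm_le_level_bound[OF B]]
      d_inf_le[OF A B v(2) norm_le_level_bound[OF B]]
      rho_le[OF A B v(2) norm_le_level_bound[OF B]] by auto
  \<comment> \<open>The strict inequality \<open>gt\<close> excludes \<open>v = 0\<close>, so
    \<open>sgn v\<close> is a unit vector.\<close>
  with gt norm_le_supp_sgn[OF A v(1)] show ?thesis
    by (intro bexI[of _ "sgn v"]) (auto simp: norm_sgn)
qed

lemma depth_dist_tendsto_0: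
  fixes P :: "'w measure" and X :: "'w \<Rightarrow> real ^ 'n \<Rightarrow> real"
  assumes "prob_space P" "fuzzy_random_variable P X"
    and A: "A \<in> Fc" and A': "\<And>n. A' n \<in> Fc"
    and d: "d \<in> {d_fin r | r. r \<ge> 1} \<union> {d_inf} \<union> {rho r | r. r \<ge> 1}"
    and lim: "filterlim (\<lambda>n. d (A' n) A) at_top F"
  shows "((\<lambda>n. naive_simplicial_depth P (A' n) X) \<longlongrightarrow> 0) F"
proof (rule depth_tendsto_0[OF assms(1,2)])
  show "filterlim (\<lambda>n. d (A' n) A - level_bound A) at_top F"
    using filterlim_tendsto_add_at_top[OF tendsto_const[of "- level_bound A"] lim] by simp
  have "\<forall>\<^sub>F n in F. d (A' n) A > level_bound A"
    using lim by (simp add: filterlim_at_top_dense)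
  then show "\<forall>\<^sub>F n in F. \<exists>u\<in>sphere 0 1. d (A' n) A - level_bound A \<le> supp (A' n) u 0"
    by eventually_elim (rule supp_ge_dist[OF A' A d])
qed

section \<open>Equivariance, rays and divergent sequences combined\<close>

theorem theorem5p5:
  fixes P :: "'w measure" and X :: "'w \<Rightarrow> real ^ 'n \<Rightarrow> real"
  assumes "prob_space P" and "fuzzy_random_variable P X"
  shows
    "(\<forall>M :: real ^ 'n ^ 'n. invertible M \<longrightarrow> (\<forall>B\<in>Fc. \<forall>C\<in>Fc.
        naive_simplicial_depth P (M \<odot>\<^sub>F C \<oplus>\<^sub>F B) (\<lambda>\<omega>. M \<odot>\<^sub>F X \<omega> \<oplus>\<^sub>F B)
          = naive_simplicial_depth P C X)) \<and>
     (\<forall>A\<in>Fc. naive_simplicial_depth P A X = (SUP B\<in>Fc. naive_simplicial_depth P B X) \<longrightarrow>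
        (\<forall>B\<in>Fc - {indicator {0}}.
           ((\<lambda>l :: real. naive_simplicial_depth P (A \<oplus>\<^sub>F l \<cdot>\<^sub>F B) X) \<longlongrightarrow> 0) at_top) \<and>
        (\<forall>d \<in> {d_fin r | r. r \<ge> 1} \<union> {d_inf} \<union> {rho r | r. r \<ge> 1}.
           \<forall>A' :: nat \<Rightarrow> real ^ 'n \<Rightarrow> real.
             (\<forall>n. A' n \<in> Fc) \<longrightarrow> filterlim (\<lambda>n. d (A' n) A) at_top sequentially \<longrightarrow>
             (\<lambda>n. naive_simplicial_depth P (A' n) X) \<longlonglongrightarrow> 0))"
proof (intro conjI allI ballI impI)
  fix M :: "real ^ 'n ^ 'n" and B C :: "real ^ 'n \<Rightarrow> real"
  assume "invertible M" "B \<in> Fc" "C \<in> Fc"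
  then show "naive_simplicial_depth P (M \<odot>\<^sub>F C \<oplus>\<^sub>F B) (\<lambda>\<omega>. M \<odot>\<^sub>F X \<omega> \<oplus>\<^sub>F B)
      = naive_simplicial_depth P C X"
    using assms(2) by (intro depth_affine) (auto simp: fuzzy_random_variable_def)
next
  fix A B :: "real ^ 'n \<Rightarrow> real"
  assume "A \<in> Fc" "B \<in> Fc - {indicator {0}}"
  then show "((\<lambda>l :: real. naive_simplicial_depth P (A \<oplus>\<^sub>F l \<cdot>\<^sub>F B) X) \<longlongrightarrow> 0) at_top"
    using depth_ray_tendsto_0[OF assms] by blast
next
  fix A :: "real ^ 'n \<Rightarrow> real" and d and A' :: "nat \<Rightarrow> real ^ 'n \<Rightarrow> real"
  assume "A \<in> Fc" "d \<in> {d_fin r | r. r \<ge> 1} \<union> {d_inf} \<union> {rho r | r. r \<ge> 1}"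
    "\<forall>n. A' n \<in> Fc" "filterlim (\<lambda>n. d (A' n) A) at_top sequentially"
  then show "(\<lambda>n. naive_simplicial_depth P (A' n) X) \<longlonglongrightarrow> 0"
    using depth_dist_tendsto_0[OF assms] by blast
qed

end
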